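(* Let $q$ be a prime power, let $n$ be a positive integer, and let $\alpha_{n-1},\beta_{n-1},\alpha_n,\beta_n\in\mathbb{F}_q$ satisfy $\alpha_n\neq 0$ and $\alpha_{n-1}\beta_n-\alpha_n\beta_{n-1}\neq 0$. Let $F:\mathbb{F}_q\to\mathbb{F}_q$ be any map satisfying $$F(c)=\frac{\alpha_{n-1}c+\beta_{n-1}}{\alpha_n c+\beta_n}+c$$ for at least $q-n$ different $c\in\mathbb{F}_q$. Then the value set $V_F=\{F(c): c\in\mathbb{F}_q\}$ satisfies $$\left\lceil\frac{q-n}{2}\right\rceil\le |V_F|\le \min\left\{n+\left\lfloor\frac{q+1}{2}\right\rfloor,\; q\right\}.$$
   Context: $\mathbb{F}_q$ denotes the finite field with $q$ elements. The displayed equality for a given $c$ is understood to hold only when the fraction is defined, i.e. it includes $\alpha_n c+\beta_n\neq 0$. The elements $\alpha_{n-1},\beta_{n-1},\alpha_n,\beta_n$ are four arbitrary field elements subject only to the stated conditions; their subscripts are just labels. *)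

theory Defs
  imports Complex_Main "HOL-Library.Cardinality"
begin

end

theory Submission
  imports Defs
begin

text \<open>
  Write \<open>R c = (a * c + b) / (\<alpha> * c + \<beta>) + c\<close> for the rational function, \<open>p c = \<alpha> * c + \<beta>\<close> for its
  denominator, and \<open>U\<close> for the \<open>q - 1\<close> points at which \<open>p\<close> does not vanish.  Up to an affine change of
  coordinates \<open>R\<close> is \<open>p + e / p\<close> with \<open>e = b * \<alpha> - a * \<beta> \<noteq> 0\<close>, so it takes equal values at
  distinct points \<open>x\<close>, \<open>y\<close> of \<open>U\<close> exactly if \<open>p x * p y = e\<close>
  (\<open>moebius_plus_id_eq_iff\<close>).  In other words, the fibres of \<open>R\<close> on \<open>U\<close> are the orbits of the map
  \<open>\<sigma>\<close> of \<open>U\<close> that replaces \<open>p\<close> by \<open>e / p\<close> (\<open>fibre_partner\<close>).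

  Orbits have at most two points, so the set \<open>S\<close> of at least \<open>q - n\<close> points where \<open>F\<close> agrees with \<open>R\<close>
  already yields \<open>\<lceil>(q - n) / 2\<rceil>\<close> values of \<open>F\<close> (\<open>card_le_double_card_image\<close>).
  Conversely, a one-point orbit is a solution of \<open>p ^ 2 = e\<close>, of which there are at most two
  (\<open>card_affine_square_roots_le_2\<close>); hence \<open>R\<close> has at most
  \<open>((q - 1) + 2) / 2\<close> values on \<open>U\<close> (\<open>double_card_image_le_card_plus_fixed\<close>), and the at
  most \<open>n\<close> points outside \<open>S\<close> add at most \<open>n\<close> further values of \<open>F\<close>.
\<close>

section \<open>Counting values by fibres\<close>

lemma card_le_double_card_image:
  fixes f :: "'a \<Rightarrow> 'b"
  assumes "finite S"
    and fibre: "\<And>x y. x \<in> S \<Longrightarrow> y \<in> S \<Longrightarrow> f x = f y \<Longrightarrow> y = x \<or> y = \<sigma> x"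
  shows "card S \<le> 2 * card (f ` S)"
proof -
  have "card {x \<in> S. f x = v} \<le> 2" if "v \<in> f ` S" for v
  proof -
    from that obtain x where x: "x \<in> S" "v = f x" by auto
    then have "{y \<in> S. f y = v} \<subseteq> {x, \<sigma> x}" using fibre by force
    then have "card {y \<in> S. f y = v} \<le> card {x, \<sigma> x}" by (intro card_mono) auto
    also have "\<dots> \<le> 2" by (simp add: card_insert_if)
    finally show ?thesis .
  qed
  then have "(\<Sum>v \<in> f ` S. card {x \<in> S. f x = v}) \<le> (\<Sum>v \<in> f ` S. 2)"
    by (intro sum_mono)
  moreover have "card S = (\<Sum>v \<in> f ` S. card {x \<in> S. f x = v})"
    using sum.image_gen[OF \<open>finite S\<close>, of "\<lambda>_. 1::nat" f] by simp
  ultimately show ?thesis by simp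
qed

text \<open>
  Count each fixed point of \<open>\<sigma>\<close> with weight two and every other point with weight one.  Then each
  fibre of \<open>f\<close> has total weight at least two, because a point that \<open>\<sigma>\<close> moves shares its fibre with
  its image.
\<close>

lemma double_card_image_le_card_plus_fixed:
  fixes f :: "'a \<Rightarrow> 'b"
  assumes "finite U"
    and closed: "\<And>x. x \<in> U \<Longrightarrow> \<sigma> x \<in> U"
    and invariant: "\<And>x. x \<in> U \<Longrightarrow> f (\<sigma> x) = f x"
  shows "2 * card (f ` U) \<le> card U + card {x \<in> U. \<sigma> x = x}"
proof -
  define w where "w x = (1::nat) + (if \<sigma> x = x then 1 else 0)" for x
  have "2 \<le> sum w {x \<in> U. f x = v}" if "v \<in> f ` U" for v
  proof -
    from that obtain x where x: "x \<in> U" "v = f x" by auto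
    have "2 \<le> sum w {x, \<sigma> x}" by (cases "\<sigma> x = x") (simp_all add: w_def)
    also have "\<dots> \<le> sum w {x \<in> U. f x = v}"
      using x closed invariant \<open>finite U\<close> by (intro sum_mono2) auto
    finally show ?thesis .
  qed
  then have "(\<Sum>v \<in> f ` U. 2) \<le> (\<Sum>v \<in> f ` U. sum w {x \<in> U. f x = v})"
    by (intro sum_mono)
  also have "\<dots> = sum w U"
    using sum.image_gen[OF \<open>finite U\<close>, of w f] by simp
  also have "\<dots> = card U + card {x \<in> U. \<sigma> x = x}"
    unfolding w_def sum.distrib using \<open>finite U\<close> by (simp add: sum.If_cases Int_def)
  finally show ?thesis by simp
qed

section \<open>The fibres of the rational function\<close>

text \<open>
  The difference of the two values is \<open>(x - y) * (1 - e / (p x * p y))\<close>, where \<open>p\<close> is the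
  denominator and \<open>e = b * \<alpha> - a * \<beta>\<close>.
\<close>

lemma moebius_plus_id_eq_iff:
  fixes a b \<alpha> \<beta> x y :: "'a :: field"
  assumes "\<alpha> * x + \<beta> \<noteq> 0" and "\<alpha> * y + \<beta> \<noteq> 0"
  shows "(a * x + b) / (\<alpha> * x + \<beta>) + x = (a * y + b) / (\<alpha> * y + \<beta>) + y \<longleftrightarrow>
         x = y \<or> (\<alpha> * x + \<beta>) * (\<alpha> * y + \<beta>) = b * \<alpha> - a * \<beta>"
    (is "?Rx = ?Ry \<longleftrightarrow> _")
proof -
  define s t where "s = \<alpha> * x + \<beta>" and "t = \<alpha> * y + \<beta>"
  have nz: "s \<noteq> 0" "t \<noteq> 0" using assms by (simp_all add: s_def t_def)
  have "(?Rx - ?Ry) * (s * t) = (a * x + b) * t - (a * y + b) * s + (x - y) * (s * t)"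
    unfolding s_def[symmetric] t_def[symmetric] using nz by (simp add: field_simps)
  also have "\<dots> = (x - y) * (s * t - (b * \<alpha> - a * \<beta>))"
    by (simp add: s_def t_def algebra_simps)
  finally have "?Rx - ?Ry = 0 \<longleftrightarrow> (x - y) * (s * t - (b * \<alpha> - a * \<beta>)) = 0"
    using nz by (metis mult_eq_0_iff)
  then show ?thesis by (simp add: s_def t_def)
qed

text \<open>The point at which the denominator takes the value \<open>e / (\<alpha> * x + \<beta>)\<close>.\<close>

definition fibre_partner :: "'a::field \<Rightarrow> 'a \<Rightarrow> 'a \<Rightarrow> 'a \<Rightarrow> 'a" where
  "fibre_partner e \<alpha> \<beta> x = (e / (\<alpha> * x + \<beta>) - \<beta>) / \<alpha>"

lemma fibre_partner_iff:
  fixes e \<alpha> \<beta> x y :: "'a :: field"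
  assumes "\<alpha> \<noteq> 0" and "\<alpha> * x + \<beta> \<noteq> 0"
  shows "y = fibre_partner e \<alpha> \<beta> x \<longleftrightarrow> (\<alpha> * x + \<beta>) * (\<alpha> * y + \<beta>) = e"
proof -
  have "y = fibre_partner e \<alpha> \<beta> x \<longleftrightarrow> \<alpha> * y + \<beta> = e / (\<alpha> * x + \<beta>)"
    using assms(1) by (auto simp: fibre_partner_def eq_divide_eq eq_diff_eq mult.commute)
  also have "\<dots> \<longleftrightarrow> (\<alpha> * x + \<beta>) * (\<alpha> * y + \<beta>) = e"
    using assms(2) by (simp add: eq_divide_eq mult.commute)
  finally show ?thesis .
qed

lemma card_affine_square_roots_le_2:
  fixes e \<alpha> \<beta> :: "'a :: field"
  assumes "\<alpha> \<noteq> 0"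
  shows "card {x. (\<alpha> * x + \<beta>) * (\<alpha> * x + \<beta>) = e} \<le> 2" (is "card ?Z \<le> 2")
proof (cases "?Z = {}")
  case False
  then obtain z where z: "(\<alpha> * z + \<beta>) * (\<alpha> * z + \<beta>) = e" by auto
  have "x = z \<or> x = (- (\<alpha> * z + \<beta>) - \<beta>) / \<alpha>" if "x \<in> ?Z" for x
  proof -
    have "\<alpha> * x + \<beta> = \<alpha> * z + \<beta> \<or> \<alpha> * x + \<beta> = - (\<alpha> * z + \<beta>)"
      using that z by (intro square_eq_iff[THEN iffD1]) simp
    then have "\<alpha> * x = \<alpha> * z \<or> \<alpha> * x = - (\<alpha> * z + \<beta>) - \<beta>"
      by (metis add_diff_cancel_right')
    then show ?thesis
      using assms by (metis mult_cancel_left nonzero_mult_div_cancel_left)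
  qed
  then have "?Z \<subseteq> {z, (- (\<alpha> * z + \<beta>) - \<beta>) / \<alpha>}" by blast
  then have "card ?Z \<le> card {z, (- (\<alpha> * z + \<beta>) - \<beta>) / \<alpha>}" by (intro card_mono) auto
  also have "\<dots> \<le> 2" by (simp add: card_insert_if)
  finally show ?thesis .
qed (simp only: card.empty)

lemma card_affine_nonzero:
  fixes \<alpha> \<beta> :: "'a :: {field, finite}"
  assumes "\<alpha> \<noteq> 0"
  shows "card {x. \<alpha> * x + \<beta> \<noteq> 0} = CARD('a) - 1"
proof -
  have "{x. \<alpha> * x + \<beta> \<noteq> 0} = UNIV - {- \<beta> / \<alpha>}"
    using assms by (simp add: set_eq_iff nonzero_eq_divide_eq eq_neg_iff_add_eq_0 mult.commute
        del: divide_minus_left minus_divide_left)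
  then show ?thesis by (simp add: card_Diff_singleton)
qed

text \<open>
  The hypothesis that \<open>a * \<beta> - \<alpha> * b\<close> is nonzero guarantees that the partner of a point avoids the
  pole, so that \<open>fibre_partner\<close> acts on the domain of the rational function.
\<close>

lemma double_card_moebius_plus_id_image_le:
  fixes a b \<alpha> \<beta> :: "'a :: {field, finite}"
  assumes "\<alpha> \<noteq> 0" and "a * \<beta> - \<alpha> * b \<noteq> 0"
  shows "2 * card ((\<lambda>c. (a * c + b) / (\<alpha> * c + \<beta>) + c) ` {c. \<alpha> * c + \<beta> \<noteq> 0}) \<le> CARD('a) + 1"
    (is "2 * card (?R ` ?U) \<le> _")
proof -
  define e where "e = b * \<alpha> - a * \<beta>"
  define \<sigma> where "\<sigma> = fibre_partner e \<alpha> \<beta>"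
  have "e \<noteq> 0" using assms(2) by (simp add: e_def mult.commute)
  have partner: "(\<alpha> * x + \<beta>) * (\<alpha> * \<sigma> x + \<beta>) = e" if "x \<in> ?U" for x
    using that fibre_partner_iff[OF assms(1)] by (auto simp: \<sigma>_def)
  have closed: "\<sigma> x \<in> ?U" if "x \<in> ?U" for x
    using partner[OF that] \<open>e \<noteq> 0\<close> by auto
  have invariant: "?R (\<sigma> x) = ?R x" if "x \<in> ?U" for x
    using moebius_plus_id_eq_iff[of \<alpha> x \<beta> "\<sigma> x" a b] partner[OF that] that closed[OF that]
    by (simp add: e_def)
  have "2 * card (?R ` ?U) \<le> card ?U + card {x \<in> ?U. \<sigma> x = x}"
    by (rule double_card_image_le_card_plus_fixed) (simp_all only: finite closed invariant)
  moreover have "card {x \<in> ?U. \<sigma> x = x} \<le> card {x. (\<alpha> * x + \<beta>) * (\<alpha> * x + \<beta>) = e}"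
    using partner by (intro card_mono) fastforce+
  moreover have "\<dots> \<le> 2"
    by (rule card_affine_square_roots_le_2[OF assms(1)])
  moreover have "card ?U = CARD('a) - 1"
    by (rule card_affine_nonzero[OF assms(1)])
  moreover have "CARD('a) > 0" by (simp add: card_gt_0_iff)
  ultimately show ?thesis by linarith
qed

section \<open>The value set of a map that agrees with the rational function at most points\<close>

theorem theorem3:
  fixes q n :: nat
    and \<alpha>_pred \<beta>_pred \<alpha>_n \<beta>_n :: "'a :: {field, finite}"
    and F :: "'a \<Rightarrow> 'a"
  assumes "CARD('a) = q"
    and "n > 0"
    and "\<alpha>_n \<noteq> 0"
    and "\<alpha>_pred * \<beta>_n - \<alpha>_n * \<beta>_pred \<noteq> 0"
    and "int (card {c. \<alpha>_n * c + \<beta>_n \<noteq> 0 \<and>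
                       F c = (\<alpha>_pred * c + \<beta>_pred) / (\<alpha>_n * c + \<beta>_n) + c}) \<ge> int q - int n"
  shows "\<lceil>(real q - real n) / 2\<rceil> \<le> int (card (range F)) \<and>
         int (card (range F)) \<le> min (int n + \<lfloor>(real q + 1) / 2\<rfloor>) (int q)"
proof -
  let ?R = "\<lambda>c. (\<alpha>_pred * c + \<beta>_pred) / (\<alpha>_n * c + \<beta>_n) + c"
  let ?U = "{c. \<alpha>_n * c + \<beta>_n \<noteq> 0}"
  define S where "S = {c. \<alpha>_n * c + \<beta>_n \<noteq> 0 \<and> F c = ?R c}"
  define e where "e = \<beta>_pred * \<alpha>_n - \<alpha>_pred * \<beta>_n"
  have card_S: "int (card S) \<ge> int q - int n" using assms(5) by (simp only: S_def)

  have fibre: "y = x \<or> y = fibre_partner e \<alpha>_n \<beta>_n x" if "x \<in> S" "y \<in> S" "F x = F y" for x y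
    using that moebius_plus_id_eq_iff[of \<alpha>_n x \<beta>_n y \<alpha>_pred \<beta>_pred]
      fibre_partner_iff[OF assms(3), of x \<beta>_n y e]
    by (auto simp: S_def e_def)
  have "card S \<le> 2 * card (F ` S)"
    by (rule card_le_double_card_image[OF _ fibre]) simp_all
  moreover have "card (F ` S) \<le> card (range F)" by (intro card_mono) auto
  ultimately have "real q - real n \<le> 2 * real (card (range F))" using card_S by linarith
  then have lower: "\<lceil>(real q - real n) / 2\<rceil> \<le> int (card (range F))"
    by (simp add: ceiling_le_iff)

  have "card (- S) \<le> n"
    using card_S assms(1) by (simp add: Compl_eq_Diff_UNIV card_Diff_subset)
  then have outside: "card (F ` (- S)) \<le> n"
    using card_image_le[of "- S" F] by simp
  have "F ` S \<subseteq> ?R ` ?U" by (auto simp: S_def)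
  then have inside: "card (F ` S) \<le> card (?R ` ?U)" by (intro card_mono) auto
  have "range F = F ` S \<union> F ` (- S)" by (auto simp flip: image_Un)
  then have "card (range F) \<le> card (F ` S) + card (F ` (- S))"
    by (simp add: card_Un_le)
  with inside outside have "card (range F) \<le> card (?R ` ?U) + n" by linarith
  moreover have "int (card (?R ` ?U)) \<le> \<lfloor>(real q + 1) / 2\<rfloor>"
    using double_card_moebius_plus_id_image_le[OF assms(3,4)] assms(1)
    by (simp add: le_floor_iff of_nat_le_iff[of "2 * _" "q + 1", where 'a = real, symmetric]
        del: of_nat_le_iff)
  ultimately have "int (card (range F)) \<le> int n + \<lfloor>(real q + 1) / 2\<rfloor>" by linarith
  moreover have "card (range F) \<le> q"
    using assms(1) card_image_le[of UNIV F] by simp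
  ultimately show ?thesis using lower by simp
qed

end
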